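(* Let $A$ be an asymmetric fuzzy number with $[A]_1=\{a_m\}$. For every $B=r+qA\in\mathbb{R}_{\mathcal{F}(A)}$, we have $0\leq B^2$, where $B^2=B\odot B$. Moreover, $B^2=0$ if and only if $r+qa_m=0$.
   Context: A fuzzy subset of $\mathbb{R}$ is a function $A:\mathbb{R}\to[0,1]$; its $\alpha$-levels are $[A]_\alpha=\{x: A(x)\geq\alpha\}$ for $0<\alpha\leq1$ and $[A]_0=\overline{\{x:A(x)>0\}}$. $A$ is a fuzzy number if all its $\alpha$-levels are nonempty closed intervals and $\{x:A(x)>0\}$ is bounded. For $r,q\in\mathbb{R}$, $r+qA$ is the fuzzy number with $[r+qA]_\alpha=\{r+qx: x\in[A]_\alpha\}$ for every $\alpha\in[0,1]$; $r+0A$ is identified with the real number $r$. $A$ is asymmetric if for every $x\in\mathbb{R}$ there exists $y\in\mathbb{R}$ with $A(x-y)\neq A(x+y)$. Put $\mathbb{R}_{\mathcal{F}(A)}=\{r+qA: r,q\in\mathbb{R}\}$. When $A$ is asymmetric, $(r,q)\mapsto r+qA$ is a bijection from $\mathbb{R}^2$ onto $\mathbb{R}_{\mathcal{F}(A)}$, and $\mathbb{R}_{\mathcal{F}(A)}$ is a real vector space with $(r_B+q_BA)\oplus(r_C+q_CA)=(r_B+r_C)+(q_B+q_C)A$ and $\lambda(r+qA)=\lambda r+(\lambda q)A$. $\Psi$-cross product (for $[A]_1=\{a_m\}$): for $B,C\in\mathbb{R}_{\mathcal{F}(A)}$ with $[B]_1=\{b\}$, $[C]_1=\{c\}$, $B\odot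 C=cB+bC-bc$ (sum in the vector space $\mathbb{R}_{\mathcal{F}(A)}$ with addition $\oplus$, i.e. $B\odot C=cB\oplus bC\oplus(-bc)$); equivalently, for $B=r_B+q_BA$, $C=r_C+q_CA$, $$B\odot C=(r_Br_C-a_m^2q_Bq_C)+(r_Bq_C+r_Cq_B+2a_mq_Bq_C)A.$$ Order: for $B=r_B+q_BA$, $C=r_C+q_CA$, $B\leq C$ if and only if (I) $r_B+q_Ba_m<r_C+q_Ca_m$; or (II) $r_B+q_Ba_m=r_C+q_Ca_m$ and $|q_B|<|q_C|$; or (III) $r_B+q_Ba_m=r_C+q_Ca_m$, $|q_B|=|q_C|$ and $q_B\leq q_C$. *)

theory Defs
  imports "HOL-Analysis.Analysis"
begin

definition level :: "(real \<Rightarrow> real) \<Rightarrow> real \<Rightarrow> real set" where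
  "level A \<alpha> = (if \<alpha> = 0 then closure {x. A x > 0} else {x. A x \<ge> \<alpha>})"

definition fuzzy_number :: "(real \<Rightarrow> real) \<Rightarrow> bool" where
  "fuzzy_number A \<longleftrightarrow>
     (\<forall>x. A x \<in> {0..1}) \<and>
     (\<forall>\<alpha>\<in>{0..1}. \<exists>l u. l \<le> u \<and> level A \<alpha> = {l..u}) \<and>
     bounded {x. A x > 0}"

definition fuzzy_asymmetric :: "(real \<Rightarrow> real) \<Rightarrow> bool" where
  "fuzzy_asymmetric A \<longleftrightarrow> (\<forall>x. \<exists>y. A (x - y) \<noteq> A (x + y))"

text \<open>The fuzzy number \<open>r + qA\<close>. It exists and is unique for every fuzzy number \<open>A\<close>,
  see \<open>fuzzy_affine_unique\<close> below.\<close>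

definition fuzzy_affine :: "(real \<Rightarrow> real) \<Rightarrow> real \<Rightarrow> real \<Rightarrow> (real \<Rightarrow> real)" where
  "fuzzy_affine A r q =
     (THE B. fuzzy_number B \<and> (\<forall>\<alpha>\<in>{0..1}. level B \<alpha> = (\<lambda>x. r + q * x) ` level A \<alpha>))"

text \<open>The fuzzy number identified with the real number \<open>r\<close>; it is \<open>r + 0A\<close>,
  see \<open>fuzzy_affine_zero\<close> below.\<close>

definition crisp :: "real \<Rightarrow> (real \<Rightarrow> real)" where
  "crisp r = indicator {r}"

definition fuzzy_space :: "(real \<Rightarrow> real) \<Rightarrow> (real \<Rightarrow> real) set" where
  "fuzzy_space A = {fuzzy_affine A r q | r q. True}"

text \<open>The coefficients \<open>(r, q)\<close> of \<open>r + qA\<close>. They are unique if \<open>A\<close> is asymmetric,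
  see \<open>bij_betw_fuzzy_affine\<close> below; the operations and the order that follow are
  meaningful only for asymmetric \<open>A\<close> and for arguments in \<open>fuzzy_space A\<close>.\<close>

definition coeffs :: "(real \<Rightarrow> real) \<Rightarrow> (real \<Rightarrow> real) \<Rightarrow> real \<times> real" where
  "coeffs A = inv_into UNIV (\<lambda>(r, q). fuzzy_affine A r q)"

definition fuzzy_add :: "(real \<Rightarrow> real) \<Rightarrow> (real \<Rightarrow> real) \<Rightarrow> (real \<Rightarrow> real) \<Rightarrow> (real \<Rightarrow> real)" where
  "fuzzy_add A B C =
     (let (r\<^sub>B, q\<^sub>B) = coeffs A B; (r\<^sub>C, q\<^sub>C) = coeffs A C
      in fuzzy_affine A (r\<^sub>B + r\<^sub>C) (q\<^sub>B + q\<^sub>C))"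

definition fuzzy_scale :: "(real \<Rightarrow> real) \<Rightarrow> real \<Rightarrow> (real \<Rightarrow> real) \<Rightarrow> (real \<Rightarrow> real)" where
  "fuzzy_scale A k B = (let (r, q) = coeffs A B in fuzzy_affine A (k * r) (k * q))"

text \<open>The only point of the 1-level, provided that level is a singleton.\<close>

definition core :: "(real \<Rightarrow> real) \<Rightarrow> real" where
  "core B = (THE b. level B 1 = {b})"

definition cross :: "(real \<Rightarrow> real) \<Rightarrow> (real \<Rightarrow> real) \<Rightarrow> (real \<Rightarrow> real) \<Rightarrow> (real \<Rightarrow> real)" where
  "cross A B C =
     (let b = core B; c = core C
      in fuzzy_add A (fuzzy_add A (fuzzy_scale A c B) (fuzzy_scale A b C)) (crisp (- (b * c))))"

definition fuzzy_le :: "(real \<Rightarrow> real) \<Rightarrow> (real \<Rightarrow> real) \<Rightarrow> (real \<Rightarrow> real) \<Rightarrow> bool" where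
  "fuzzy_le A B C \<longleftrightarrow>
     (let a = core A; (r\<^sub>B, q\<^sub>B) = coeffs A B; (r\<^sub>C, q\<^sub>C) = coeffs A C in
        r\<^sub>B + q\<^sub>B * a < r\<^sub>C + q\<^sub>C * a \<or>
        r\<^sub>B + q\<^sub>B * a = r\<^sub>C + q\<^sub>C * a \<and> \<bar>q\<^sub>B\<bar> < \<bar>q\<^sub>C\<bar> \<or>
        r\<^sub>B + q\<^sub>B * a = r\<^sub>C + q\<^sub>C * a \<and> \<bar>q\<^sub>B\<bar> = \<bar>q\<^sub>C\<bar> \<and> q\<^sub>B \<le> q\<^sub>C)"

lemma fuzzy_number_le:
  assumes B: "fuzzy_number B" and C: "fuzzy_number C"
    and eq: "\<And>\<alpha>. \<alpha> \<in> {0..1} \<Longrightarrow> level B \<alpha> = level C \<alpha>"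
  shows "B x \<le> C x"
proof (cases "B x = 0")
  case True
  have "C x \<in> {0..1}" using C unfolding fuzzy_number_def by blast
  then show ?thesis using True by simp
next
  case False
  have "B x \<in> {0..1}" using B unfolding fuzzy_number_def by blast
  then have lev: "level B (B x) = level C (B x)" by (rule eq)
  have "x \<in> level B (B x)" using False by (simp add: level_def)
  then show ?thesis unfolding lev using False by (simp add: level_def)
qed

lemma fuzzy_number_eqI:
  assumes B: "fuzzy_number B" and C: "fuzzy_number C"
    and eq: "\<And>\<alpha>. \<alpha> \<in> {0..1} \<Longrightarrow> level B \<alpha> = level C \<alpha>"
  shows "B = C"
proof (rule ext, rule antisym)
  show "B x \<le> C x" for x by (rule fuzzy_number_le[OF B C eq])
  show "C x \<le> B x" for x by (rule fuzzy_number_le[OF C B eq[symmetric]])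
qed

lemma fuzzy_number_level:
  assumes "fuzzy_number A" "\<alpha> \<in> {0..1}"
  obtains l u where "l \<le> u" "level A \<alpha> = {l..u}"
  proof -
  have "\<exists>l u. l \<le> u \<and> level A \<alpha> = {l..u}"
    using assms(1)[unfolded fuzzy_number_def, THEN conjunct2, THEN conjunct1] assms(2) by (rule bspec)
  then obtain l u where "l \<le> u \<and> level A \<alpha> = {l..u}" by (elim exE)
  then show thesis using that[of l u] by simp
qed

lemma crisp_affine:
  assumes "fuzzy_number A"
  shows "fuzzy_number (crisp r)"
    and "\<forall>\<alpha>\<in>{0..1}. level (crisp r) \<alpha> = (\<lambda>x. r + 0 * x) ` level A \<alpha>"
proof -
  have lev: "level (crisp r) \<alpha> = {r}" if "\<alpha> \<in> {0..1}" for \<alpha>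
  proof -
    have "{x. (0::real) < indicator {r} x} = {r}" by (auto simp: indicator_def)
    then show ?thesis using that by (auto simp: level_def crisp_def indicator_def)
  qed
  have "{x. 0 < crisp r x} = {r}" by (auto simp: crisp_def indicator_def)
  then have "bounded {x. 0 < crisp r x}" by simp
  moreover have "\<exists>l u. l \<le> u \<and> level (crisp r) \<alpha> = {l..u}" if "\<alpha> \<in> {0..1}" for \<alpha>
    using lev[OF that] by (intro exI[of _ r]) auto
  ultimately show "fuzzy_number (crisp r)"
    unfolding fuzzy_number_def by (auto simp: crisp_def indicator_def)
  show "\<forall>\<alpha>\<in>{0..1}. level (crisp r) \<alpha> = (\<lambda>x. r + 0 * x) ` level A \<alpha>"
  proof
    fix \<alpha> :: real
    assume \<alpha>: "\<alpha> \<in> {0..1}"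
    obtain l u where "l \<le> u" "level A \<alpha> = {l..u}"
      by (rule fuzzy_number_level[OF assms \<alpha>])
    then show "level (crisp r) \<alpha> = (\<lambda>x. r + 0 * x) ` level A \<alpha>"
      unfolding lev[OF \<alpha>] by (simp add: image_constant_conv)
  qed
qed

lemma rescaled_affine:
  fixes r q :: real
  assumes A: "fuzzy_number A" and q: "q \<noteq> 0"
  defines "B \<equiv> \<lambda>x. A ((x - r) / q)"
  shows "fuzzy_number B"
    and "\<forall>\<alpha>\<in>{0..1}. level B \<alpha> = (\<lambda>x. r + q * x) ` level A \<alpha>"
proof -
  let ?f = "\<lambda>x. r + q * x"
  have img: "{x. P ((x - r) / q)} = ?f ` {x. P x}" for P
  proof (intro set_eqI iffI)
    fix x assume "x \<in> {x. P ((x - r) / q)}"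
    then show "x \<in> ?f ` {x. P x}"
      using q by (intro image_eqI[of _ _ "(x - r) / q"]) auto
  qed (use q in auto)
  have clos: "closure (?f ` S) = ?f ` closure S" for S
  proof -
    have "?f ` T = (+) r ` ((*\<^sub>R) q ` T)" for T by (auto simp: image_image)
    then show ?thesis by (simp only: closure_translation closure_scaleR)
  qed
  have lev: "level B \<alpha> = ?f ` level A \<alpha>" for \<alpha>
    unfolding level_def B_def using img[of "\<lambda>x. A x > 0"] img[of "\<lambda>x. A x \<ge> \<alpha>"]
    by (simp add: clos)
  then show "\<forall>\<alpha>\<in>{0..1}. level B \<alpha> = ?f ` level A \<alpha>" by blast
  have "bounded (?f ` {x. A x > 0})"
  proof -
    have "bounded ((+) r ` ((*\<^sub>R) q ` {x. A x > 0}))"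
      using A by (intro bounded_translation bounded_scaling) (auto simp: fuzzy_number_def)
    then show ?thesis by (simp add: image_image)
  qed
  then have "bounded {x. B x > 0}"
    unfolding B_def using img[of "\<lambda>x. A x > 0"] by simp
  moreover have "\<exists>l u. l \<le> u \<and> level B \<alpha> = {l..u}" if \<alpha>: "\<alpha> \<in> {0..1}" for \<alpha>
  proof -
    obtain l u where lu: "l \<le> u" "level A \<alpha> = {l..u}"
      by (rule fuzzy_number_level[OF A \<alpha>])
    have "?f ` {l..u} = (\<lambda>x. q * x + r) ` {l..u}" by (simp add: add.commute)
    also have "\<dots> = (if 0 \<le> q then {q * l + r..q * u + r} else {q * u + r..q * l + r})"
      using lu by (simp add: image_affinity_atLeastAtMost)
    finally show ?thesis
      using lu lev[of \<alpha>] q by (cases "0 \<le> q") (auto simp: mult_left_mono mult_left_mono_neg)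
  qed
  ultimately show "fuzzy_number B"
    using A unfolding fuzzy_number_def B_def by auto
qed

lemma fuzzy_affine_eqI:
  assumes "fuzzy_number B" "\<forall>\<alpha>\<in>{0..1}. level B \<alpha> = (\<lambda>x. r + q * x) ` level A \<alpha>"
  shows "fuzzy_affine A r q = B"
  unfolding fuzzy_affine_def
  by (rule the_equality) (use assms in \<open>auto intro!: fuzzy_number_eqI\<close>)

lemma fuzzy_affine_unique:
  assumes "fuzzy_number A"
  shows "\<exists>!B. fuzzy_number B \<and> (\<forall>\<alpha>\<in>{0..1}. level B \<alpha> = (\<lambda>x. r + q * x) ` level A \<alpha>)"
proof (rule ex_ex1I)
  show "\<exists>B. fuzzy_number B \<and> (\<forall>\<alpha>\<in>{0..1}. level B \<alpha> = (\<lambda>x. r + q * x) ` level A \<alpha>)"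
    using crisp_affine[OF assms, of r] rescaled_affine[OF assms, of q r] by (cases "q = 0") blast+
qed (auto intro!: fuzzy_number_eqI)

lemma fuzzy_affine_zero:
  assumes "fuzzy_number A"
  shows "fuzzy_affine A r 0 = crisp r"
  using crisp_affine[OF assms] by (rule fuzzy_affine_eqI)

lemma fuzzy_affine_nonzero:
  assumes "fuzzy_number A" "q \<noteq> 0"
  shows "fuzzy_affine A r q = (\<lambda>x. A ((x - r) / q))"
  using rescaled_affine[OF assms] by (rule fuzzy_affine_eqI)

lemma level_fuzzy_affine:
  assumes "fuzzy_number A" "\<alpha> \<in> {0..1}"
  shows "level (fuzzy_affine A r q) \<alpha> = (\<lambda>x. r + q * x) ` level A \<alpha>"
  using theI'[OF fuzzy_affine_unique[OF assms(1), of r q]] assms(2)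
  unfolding fuzzy_affine_def by blast

lemma asymmetric_nondegenerate:
  assumes A: "fuzzy_number A" and asym: "fuzzy_asymmetric A"
  obtains l u where "l < u" "level A 0 = {l..u}"
proof -
  obtain l u where lu: "l \<le> u" "level A 0 = {l..u}"
    by (rule fuzzy_number_level[OF A, of 0]) auto
  have sub: "{x. A x > 0} \<subseteq> {l..u}"
    using lu closure_subset[of "{x. A x > 0}"] by (simp add: level_def)
  have "l \<noteq> u"
  proof
    assume eq: "l = u"
    have "A x = 0" if "x \<noteq> l" for x
    proof -
      have "A x \<in> {0..1}" using A unfolding fuzzy_number_def by blast
      moreover have "\<not> A x > 0" using sub eq that by auto
      ultimately show ?thesis by simp
    qed
    then have "A (l - y) = A (l + y)" for y by (cases "y = 0") auto
    then show False using asym by (auto simp: fuzzy_asymmetric_def)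
  qed
  then show thesis using that lu by simp
qed

lemma fuzzy_affine_inject:
  assumes A: "fuzzy_number A" and asym: "fuzzy_asymmetric A"
    and eq: "fuzzy_affine A r q = fuzzy_affine A r' q'"
  shows "r = r' \<and> q = q'"
proof -
  obtain l u where lu: "l < u" "level A 0 = {l..u}"
    using asymmetric_nondegenerate[OF A asym] .
  have im: "(\<lambda>x. s + p * x) ` {l..u} = {min (s + p * l) (s + p * u)..max (s + p * l) (s + p * u)}" for s p
  proof -
    have "(\<lambda>x. s + p * x) ` {l..u} = (\<lambda>x. p * x + s) ` {l..u}" by (simp add: add.commute)
    also have "\<dots> = (if 0 \<le> p then {p * l + s..p * u + s} else {p * u + s..p * l + s})"
      using lu by (simp add: image_affinity_atLeastAtMost)
    also have "\<dots> = {min (s + p * l) (s + p * u)..max (s + p * l) (s + p * u)}"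
      using lu mult_left_mono[of l u p] mult_left_mono_neg[of l u p]
      by (cases "0 \<le> p") (auto simp: min_def max_def add.commute)
    finally show ?thesis .
  qed
  have "(\<lambda>x. r + q * x) ` {l..u} = (\<lambda>x. r' + q' * x) ` {l..u}"
    using level_fuzzy_affine[OF A, of 0 r q] level_fuzzy_affine[OF A, of 0 r' q'] eq lu by simp
  then have "min (r + q * l) (r + q * u) = min (r' + q' * l) (r' + q' * u)"
    "max (r + q * l) (r + q * u) = max (r' + q' * l) (r' + q' * u)"
    unfolding im Icc_eq_Icc by auto
  then have "(r + q * l = r' + q' * l \<and> r + q * u = r' + q' * u) \<or>
             (r + q * l = r' + q' * u \<and> r + q * u = r' + q' * l)"
    by (auto simp: min_def max_def split: if_splits)
  then show ?thesis
  proof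
    assume h: "r + q * l = r' + q' * l \<and> r + q * u = r' + q' * u"
    then have "(q - q') * (u - l) = 0" by (simp add: algebra_simps)
    then show ?thesis using lu h by auto
  next
    assume h: "r + q * l = r' + q' * u \<and> r + q * u = r' + q' * l"
    then have "(q + q') * (u - l) = 0" by (simp add: algebra_simps)
    then have q': "q' = - q" using lu by auto
    show ?thesis
    proof (cases "q = 0")
      case True
      then show ?thesis using q' h by auto
    next
      case False
      then have q'_nz: "q' \<noteq> 0" using q' by simp
      have r': "r' = r + q * (l + u)" using h q' by (simp add: algebra_simps)
      have sym: "A t = A (l + u - t)" for t
      proof -
        have "A ((r + q * t - r) / q) = A ((r + q * t - r') / q')"
          using fun_cong[OF eq, of "r + q * t"]
          unfolding fuzzy_affine_nonzero[OF A False]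
            fuzzy_affine_nonzero[OF A q'_nz] .
        moreover have "(r + q * t - r) / q = t" using False by simp
        moreover have "(r + q * t - r') / q' = l + u - t"
          using False unfolding q' r' by (simp add: field_simps)
        ultimately show ?thesis by simp
      qed
      have "A ((l + u) / 2 - y) = A ((l + u) / 2 + y)" for y
        using sym[of "(l + u) / 2 - y"] by (simp add: field_simps)
      then show ?thesis using asym by (auto simp: fuzzy_asymmetric_def)
    qed
  qed
qed

lemma bij_betw_fuzzy_affine:
  assumes "fuzzy_number A" "fuzzy_asymmetric A"
  shows "bij_betw (\<lambda>(r, q). fuzzy_affine A r q) UNIV (fuzzy_space A)"
  unfolding bij_betw_def inj_on_def fuzzy_space_def
  using fuzzy_affine_inject[OF assms] by (auto simp: image_iff)

lemma coeffs_fuzzy_affine: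
  assumes "fuzzy_number A" "fuzzy_asymmetric A"
  shows "coeffs A (fuzzy_affine A r q) = (r, q)"
  using inv_into_f_f[OF bij_betw_imp_inj_on[OF bij_betw_fuzzy_affine[OF assms]], of "(r, q)"]
  by (simp add: coeffs_def)

end

theory Submission
  imports Defs
begin

text \<open>
  The \<open>\<Psi>\<close>-cross product is the Leibniz-type combination \<open>cB + bC - bc\<close>, so the passage
  from \<open>B\<close> to its core \<open>b\<close> is multiplicative: \<open>cb + bc - bc = bc\<close>. Hence the core of
  \<open>B\<^sup>2\<close> is \<open>b\<^sup>2 \<ge> 0\<close> with \<open>b = r + q a\<^sub>m\<close>. The order compares cores first, so
  \<open>b \<noteq> 0\<close> already gives \<open>0 < B\<^sup>2\<close>. If \<open>b = 0\<close>, then \<open>B\<^sup>2 = 2bB - b\<^sup>2\<close> vanishes entirely,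
  not only in its core, and \<open>0 \<le> B\<^sup>2\<close> holds by reflexivity.

  Asymmetry enters because it makes the coefficients of \<open>r + qA\<close> unique. All operations can
  then be computed on coefficients; \<open>cross_fuzzy_affine\<close> and \<open>fuzzy_le_fuzzy_affine\<close> do this.
\<close>

lemma core_eqI:
  assumes "level B 1 = {b}"
  shows "core B = b"
  using assms unfolding core_def by (intro the_equality) auto

lemma core_fuzzy_affine:
  assumes "fuzzy_number A" and "level A 1 = {a}"
  shows "core (fuzzy_affine A r q) = r + q * a"
  using assms by (intro core_eqI) (simp add: level_fuzzy_affine)

lemma fuzzy_add_fuzzy_affine:
  assumes "fuzzy_number A" and "fuzzy_asymmetric A"
  shows "fuzzy_add A (fuzzy_affine A r q) (fuzzy_affine A s p) = fuzzy_affine A (r + s) (q + p)"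
  by (simp add: fuzzy_add_def coeffs_fuzzy_affine[OF assms])

lemma fuzzy_scale_fuzzy_affine:
  assumes "fuzzy_number A" and "fuzzy_asymmetric A"
  shows "fuzzy_scale A k (fuzzy_affine A r q) = fuzzy_affine A (k * r) (k * q)"
  by (simp add: fuzzy_scale_def coeffs_fuzzy_affine[OF assms])

lemma fuzzy_affine_eq_iff:
  assumes "fuzzy_number A" and "fuzzy_asymmetric A"
  shows "fuzzy_affine A r q = fuzzy_affine A s p \<longleftrightarrow> r = s \<and> q = p"
  using fuzzy_affine_inject[OF assms] by blast

text \<open>The coefficients of the product come from expanding \<open>cB + bC - bc\<close> with
  \<open>b = r + qa\<close> and \<open>c = s + pa\<close>.\<close>

lemma cross_fuzzy_affine:
  assumes "fuzzy_number A" and "fuzzy_asymmetric A" and "level A 1 = {a}"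
  shows "cross A (fuzzy_affine A r q) (fuzzy_affine A s p) =
    fuzzy_affine A (r * s - a\<^sup>2 * q * p) (r * p + s * q + 2 * a * q * p)"
  unfolding cross_def Let_def core_fuzzy_affine[OF assms(1,3)]
    fuzzy_affine_zero[OF assms(1), symmetric]
    fuzzy_scale_fuzzy_affine[OF assms(1,2)] fuzzy_add_fuzzy_affine[OF assms(1,2)]
    fuzzy_affine_eq_iff[OF assms(1,2)]
  by (simp add: algebra_simps power2_eq_square)

lemma fuzzy_le_fuzzy_affine:
  assumes "fuzzy_number A" and "fuzzy_asymmetric A" and "level A 1 = {a}"
  shows "fuzzy_le A (fuzzy_affine A r q) (fuzzy_affine A s p) \<longleftrightarrow>
    r + q * a < s + p * a \<or>
    r + q * a = s + p * a \<and> \<bar>q\<bar> < \<bar>p\<bar> \<or>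
    r + q * a = s + p * a \<and> \<bar>q\<bar> = \<bar>p\<bar> \<and> q \<le> p"
  by (simp add: fuzzy_le_def core_eqI[OF assms(3)] coeffs_fuzzy_affine[OF assms(1,2)])

theorem proposition4:
  fixes A B :: "real \<Rightarrow> real" and a\<^sub>m r q :: real
  assumes "fuzzy_number A" and "fuzzy_asymmetric A" and "level A 1 = {a\<^sub>m}"
    and "B = fuzzy_affine A r q"
  shows "fuzzy_le A (crisp 0) (cross A B B) \<and>
         (cross A B B = crisp 0 \<longleftrightarrow> r + q * a\<^sub>m = 0)"
proof -
  define b where "b = r + q * a\<^sub>m"
  define s where "s = (r - q * a\<^sub>m) * b"
  define p where "p = 2 * q * b"
  have sq: "cross A B B = fuzzy_affine A s p"
    unfolding assms(4) cross_fuzzy_affine[OF assms(1-3)] fuzzy_affine_eq_iff[OF assms(1,2)]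
    by (simp add: s_def p_def b_def algebra_simps power2_eq_square)
  have zero: "crisp 0 = fuzzy_affine A 0 0"
    by (rule fuzzy_affine_zero[OF assms(1), symmetric])
  have core: "s + p * a\<^sub>m = b\<^sup>2"
    by (simp add: s_def p_def b_def algebra_simps power2_eq_square)
  have vanish: "s = 0 \<and> p = 0 \<longleftrightarrow> b = 0"
  proof
    assume "s = 0 \<and> p = 0"
    then show "b = 0" using core by simp
  qed (simp add: s_def p_def)
  have "fuzzy_le A (crisp 0) (cross A B B)"
    unfolding zero sq fuzzy_le_fuzzy_affine[OF assms(1-3)] core
    using vanish by (cases "b = 0") auto
  moreover have "cross A B B = crisp 0 \<longleftrightarrow> b = 0"
    unfolding zero sq fuzzy_affine_eq_iff[OF assms(1,2)] by (rule vanish)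
  ultimately show ?thesis unfolding b_def by blast
qed

end
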